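(* Let $n\ge 1$ and let $T\in\mathrm{GL}(n+1,\mathbb{R})$. Then there exist uncountably many non-zero $a\in\mathbb{R}^{n+1}$ such that $\overline{T}_a$ is a homeomorphism of $\mathbb{S}^n$ and is not expansive.
   Context: $\|\cdot\|$ is the Euclidean norm on $\mathbb{R}^{n+1}$ and $\mathbb{S}^n$ is its unit sphere, with the metric $d(x,y)=\|x-y\|$. For $T\in\mathrm{GL}(n+1,\mathbb{R})$ and $a\in\mathbb{R}^{n+1}$, the map $\overline{T}_a\colon\mathbb{S}^n\to\mathbb{S}^n$ is defined by $\overline{T}_a(x)=\dfrac{a+T(x)}{\|a+T(x)\|}$; it is a homeomorphism whenever $\|T^{-1}(a)\|<1$. A homeomorphism $f$ of a metric space $(X,d)$ is expansive if there is $\delta>0$ such that for every pair of distinct points $x,y\in X$ there is an integer $m$ with $d(f^m(x),f^m(y))>\delta$. *)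

theory Defs
  imports "HOL-Analysis.Analysis"
begin

definition normalized_affine :: "real ^ 'm ^ 'm \<Rightarrow> real ^ 'm \<Rightarrow> real ^ 'm \<Rightarrow> real ^ 'm" where
  "normalized_affine T a x = (1 / norm (a + T *v x)) *\<^sub>R (a + T *v x)"

definition self_homeomorphism :: "'a::topological_space set \<Rightarrow> ('a \<Rightarrow> 'a) \<Rightarrow> bool" where
  "self_homeomorphism X f \<longleftrightarrow> (\<exists>g. homeomorphism X X f g)"

text \<open>The integer iterate of a bijection \<open>f\<close> of \<open>X\<close>, applied to points of \<open>X\<close>;
  negative iterates use the inverse of \<open>f\<close> restricted to \<open>X\<close>.\<close>

definition int_iterate :: "'a set \<Rightarrow> ('a \<Rightarrow> 'a) \<Rightarrow> int \<Rightarrow> 'a \<Rightarrow> 'a" where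
  "int_iterate X f m = (if m \<ge> 0 then f ^^ nat m else inv_into X f ^^ nat (- m))"

text \<open>Only meaningful when \<open>f\<close> is a homeomorphism of \<open>X\<close>, which is not part of the definition.\<close>

definition expansive_on :: "'a::metric_space set \<Rightarrow> ('a \<Rightarrow> 'a) \<Rightarrow> bool" where
  "expansive_on X f \<longleftrightarrow>
     (\<exists>\<delta>>0. \<forall>x\<in>X. \<forall>y\<in>X. x \<noteq> y \<longrightarrow>
        (\<exists>m. dist (int_iterate X f m x) (int_iterate X f m y) > \<delta>))"

end

theory Submission
  imports Defs "HOL-Computational_Algebra.Fundamental_Theorem_Algebra"
begin

text \<open>
  Every linear map \<open>T\<close> of a real space of dimension at least two has an invariant plane \<open>P\<close>
  (\<open>invariant_plane\<close>). If \<open>T\<close> is invertible and \<open>a = T b\<close> with \<open>b \<in> P\<close>, then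
  \<open>a + T x \<in> P\<close> exactly when \<open>x \<in> P\<close>, so the normalised affine map carries the circle
  \<open>P \<inter> S\<close> of the unit sphere \<open>S\<close> onto itself. If also \<open>\<parallel>b\<parallel> < 1\<close>, it is a homeomorphism
  of \<open>S\<close> (\<open>normalized_affine_homeomorphism\<close>). The vectors \<open>b = c u\<close> with \<open>0 < c < 1\<close> and
  \<open>u\<close> a unit vector of \<open>P\<close> give uncountably many \<open>a\<close>. It remains to use the classical fact that a
  homeomorphism of a circle is never expansive: two distinct points of \<open>P \<inter> S\<close> whose whole orbits
  stay close together contradict expansiveness on all of \<open>S\<close>.

  For the circle, lift the iterates to the universal cover. The even iterates lift to an action
  \<open>\<Phi>\<close> of the integers on the line by increasing homeomorphisms that commute with \<open>t \<mapsto> t + 1\<close>, and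
  what is wanted is, for each \<open>\<delta> > 0\<close>, a pair \<open>x < y < x + 1\<close> with
  \<open>\<Phi> m y - \<Phi> m x \<le> \<delta>\<close> for every integer \<open>m\<close> (\<open>close_pair_exists\<close>). There are three cases.

  \<^item> There is a periodic point. Then some \<open>\<Phi> q\<close> agrees with a translation at a point. If it is that
    translation everywhere, there are only finitely many iterates modulo translations and
    continuity suffices. Otherwise the interval between some \<open>t\<close> and its image under the
    return map is wandering.
  \<^item> There is no periodic point and the orbit of \<open>0\<close> is not dense. Then a gap of the orbit closure
    is wandering.
  \<^item> The orbit of \<open>0\<close> is dense. Then \<open>0\<close> is recurrent, and because the iterates commute and are
    monotone, a close return of \<open>0\<close> forces \<open>\<Phi> q\<close> to be uniformly close to a translation. Then
    \<open>0\<close> and its translated image under \<open>\<Phi> q\<close> stay close under all iterates.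

  A wandering interval has disjoint images on a circle of finite length, so only finitely many of
  them are longer than \<open>\<delta>\<close>, and shrinking the interval takes care of those.
\<close>

section \<open>Close orbits of increasing lifts\<close>

lemma finite_separated:
  fixes a :: "'i \<Rightarrow> real"
  assumes "\<delta> > 0" and bd: "\<And>n. n \<in> N \<Longrightarrow> A \<le> a n \<and> a n \<le> B"
    and sep: "\<And>m n. m \<in> N \<Longrightarrow> n \<in> N \<Longrightarrow> m \<noteq> n \<Longrightarrow> \<bar>a m - a n\<bar> \<ge> \<delta>"
  shows "finite N"
proof (rule inj_on_finite)
  let ?k = "\<lambda>n. \<lfloor>a n / \<delta>\<rfloor>"
  show "finite {\<lfloor>A / \<delta>\<rfloor>..\<lfloor>B / \<delta>\<rfloor>}" by simp
  show "?k ` N \<subseteq> {\<lfloor>A / \<delta>\<rfloor>..\<lfloor>B / \<delta>\<rfloor>}"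
    using bd \<open>\<delta> > 0\<close> by (auto intro!: floor_mono divide_right_mono)
  show "inj_on ?k N"
  proof (rule inj_onI, rule ccontr)
    fix m n assume mn: "m \<in> N" "n \<in> N" "?k m = ?k n" "m \<noteq> n"
    have "\<bar>a m / \<delta> - a n / \<delta>\<bar> < 1"
      using mn(3) by linarith
    then have "\<bar>a m - a n\<bar> < \<delta>"
      using \<open>\<delta> > 0\<close> by (simp add: abs_less_iff field_simps)
    with sep[OF mn(1,2,4)] show False by simp
  qed
qed

text \<open>
  The iterates of an orientation-preserving circle homeomorphism, lifted to the line. The circle has
  length one, so the deck transformations are the integer translations.
\<close>

locale circle_lift_action =
  fixes \<Phi> :: "int \<Rightarrow> real \<Rightarrow> real"
  assumes zero: "\<Phi> 0 t = t"
    and add: "\<Phi> (m + n) t = \<Phi> m (\<Phi> n t)"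
    and mono: "strict_mono (\<Phi> m)"
    and cont: "isCont (\<Phi> m) t"
    and shift: "\<Phi> m (t + 1) = \<Phi> m t + 1"
begin

lemma shift_int: "\<Phi> m (t + of_int k) = \<Phi> m t + of_int k"
proof (induction k rule: int_induct[where k = 0])
  case base show ?case by simp
next
  case (step1 i)
  then show ?case using shift[of m "t + of_int i"] by (simp add: add.assoc)
next
  case (step2 i)
  then show ?case using shift[of m "t + of_int (i - 1)"] by (simp add: add.assoc)
qed

lemma commute: "\<Phi> m (\<Phi> n t) = \<Phi> n (\<Phi> m t)"
  by (metis add add.commute)

lemma less: "\<Phi> m s < \<Phi> m t \<longleftrightarrow> s < t"
  using mono[of m] by (simp add: strict_mono_less)

lemma le: "\<Phi> m s \<le> \<Phi> m t \<longleftrightarrow> s \<le> t"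
  using mono[of m] by (simp add: strict_mono_less_eq)

lemma minus: "\<Phi> (- m) (\<Phi> m t) = t"
  by (metis add zero add.left_inverse)

lemma close_on_finite:
  fixes N :: "int set" and x y :: real
  assumes "finite N" "x < y" "\<delta> > 0"
  obtains z :: real where "x < z" "z < y" "\<And>n w. n \<in> N \<Longrightarrow> x \<le> w \<Longrightarrow> w \<le> z \<Longrightarrow> \<Phi> n w - \<Phi> n x \<le> \<delta>"
proof -
  have "\<forall>n\<in>N. \<forall>\<^sub>F z in at_right x. \<Phi> n z < \<Phi> n x + \<delta>"
  proof
    fix n
    have "(\<Phi> n \<longlongrightarrow> \<Phi> n x) (at_right x)"
      using cont[of x n] by (simp add: isCont_def filterlim_at_split)
    then show "\<forall>\<^sub>F z in at_right x. \<Phi> n z < \<Phi> n x + \<delta>"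
      by (rule order_tendstoD) (use \<open>\<delta> > 0\<close> in simp)
  qed
  then have "\<forall>\<^sub>F z in at_right x. \<forall>n\<in>N. \<Phi> n z < \<Phi> n x + \<delta>"
    using \<open>finite N\<close> by (simp add: eventually_ball_finite)
  moreover have "\<forall>\<^sub>F z in at_right x. z < y \<and> x < z"
    using \<open>x < y\<close> by (simp add: eventually_at_right_less eventually_conj_iff eventually_at_right_real eventually_at_right_field) (metis dense)
  ultimately have "\<forall>\<^sub>F z in at_right x. (\<forall>n\<in>N. \<Phi> n z < \<Phi> n x + \<delta>) \<and> z < y \<and> x < z"
    by (simp add: eventually_conj_iff)
  then obtain z where z: "\<forall>n\<in>N. \<Phi> n z < \<Phi> n x + \<delta>" "z < y" "x < z"
    using eventually_happens'[OF trivial_limit_at_right_real] by blast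
  show ?thesis
  proof (rule that[OF z(3,2)])
    fix n w assume "n \<in> N" "x \<le> w" "w \<le> z"
    then show "\<Phi> n w - \<Phi> n x \<le> \<delta>"
      using z(1) le[of n w z] by fastforce
  qed
qed

text \<open>
  The bound \<open>y < x + 1\<close> makes \<open>x\<close> and \<open>y\<close> project to different points of the circle, so close
  pairs for all \<open>\<delta>\<close> are what refutes expansiveness.
\<close>

definition close_pair :: "real \<Rightarrow> bool" where
  "close_pair \<delta> \<longleftrightarrow> (\<exists>x y. x < y \<and> y < x + 1 \<and> (\<forall>m. \<bar>\<Phi> m y - \<Phi> m x\<bar> \<le> \<delta>))"

text \<open>
  The images of a shorter interval are contained in those of the longer one, so only the finitely
  many large images need attention, and continuity makes these small.
\<close>

lemma close_pair_if_finitely_many_large: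
  assumes "x < y" "\<delta> > 0" "finite {n. \<Phi> n y - \<Phi> n x > \<delta>}"
  shows "close_pair \<delta>"
proof -
  obtain z where z: "x < z" "z < min y (x + 1)"
    "\<And>n w. n \<in> {n. \<Phi> n y - \<Phi> n x > \<delta>} \<Longrightarrow> x \<le> w \<Longrightarrow> w \<le> z \<Longrightarrow> \<Phi> n w - \<Phi> n x \<le> \<delta>"
    by (rule close_on_finite[OF assms(3) _ \<open>\<delta> > 0\<close>, of x "min y (x + 1)"]) (use \<open>x < y\<close> in simp, rule that)
  have "\<bar>\<Phi> m z - \<Phi> m x\<bar> \<le> \<delta>" for m
  proof -
    have "\<Phi> m x < \<Phi> m z" "\<Phi> m z \<le> \<Phi> m y" using z(1,2) by (simp_all add: less le)
    then show ?thesis using z(3)[of m z] z(1,2) by (cases "\<Phi> m y - \<Phi> m x > \<delta>") auto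
  qed
  then show ?thesis unfolding close_pair_def using z(1,2) by (intro exI[of _ x] exI[of _ z]) simp
qed

lemma power_shift:
  assumes "\<Phi> q t = t + of_int p"
  shows "\<Phi> (q * m) t = t + of_int (p * m)"
proof (induction m rule: int_induct[where k = 0])
  case base show ?case by (simp add: zero)
next
  case (step1 i)
  have "\<Phi> (q * (i + 1)) t = \<Phi> q (\<Phi> (q * i) t)" unfolding add[symmetric] by (simp add: algebra_simps)
  then show ?case unfolding step1.IH shift_int assms by (simp add: algebra_simps)
next
  case (step2 i)
  have *: "\<Phi> (- q) t = t + of_int (- p)"
    using shift_int[of "- q" t p] assms minus[of q t] by simp
  have "\<Phi> (q * (i - 1)) t = \<Phi> (- q) (\<Phi> (q * i) t)" unfolding add[symmetric] by (simp add: algebra_simps)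
  then show ?case unfolding step2.IH shift_int * by (simp add: algebra_simps)
qed

text \<open>
  The return map \<open>H = \<Phi> q - p\<close> fixes \<open>\<alpha>\<close>, and hence maps \<open>[\<alpha>, \<alpha> + 1]\<close> increasingly onto itself. The
  \<open>H\<close>-orbit of a point \<open>s\<close> there with \<open>H s > s\<close> increases, so the intervals between consecutive orbit
  points are disjoint inside a bounded interval. The remaining iterates of \<open>[s, H s]\<close> are images of
  these intervals under \<open>\<Phi> i\<close> for the finitely many remainders \<open>i\<close> modulo \<open>q\<close>.
\<close>

lemma close_pair_if_fixed:
  assumes q: "q \<noteq> 0" and \<alpha>: "\<Phi> q \<alpha> = \<alpha> + of_int p" and "\<delta> > 0"
    and t: "\<Phi> q t > t + of_int p"
  shows "close_pair \<delta>"
proof -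
  \<comment> \<open>Translate \<open>t\<close> into the fundamental domain that starts at the fixed point.\<close>
  obtain s k where s: "\<alpha> \<le> s" "s < \<alpha> + 1" and ts: "t = s + of_int k"
  proof
    show "\<alpha> \<le> t - of_int \<lfloor>t - \<alpha>\<rfloor>" "t - of_int \<lfloor>t - \<alpha>\<rfloor> < \<alpha> + 1" by linarith+
  qed simp
  have qs: "\<Phi> q s > s + of_int p"
    using t unfolding ts by (simp add: shift_int)
  define y where "y = \<Phi> q s - of_int p"
  have "s < y" using qs by (simp add: y_def)
  \<comment> \<open>The orbit of \<open>s\<close> under the return map.\<close>
  define x where "x m = \<Phi> (q * m) s - of_int (p * m)" for m
  have x_lim: "\<alpha> \<le> x m" "x m \<le> \<alpha> + 1" for m
    using le[of "q * m" \<alpha> s] le[of "q * m" s "\<alpha> + 1"] s power_shift[OF \<alpha>, of m] shift[of "q * m" \<alpha>]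
    by (auto simp: x_def)
  have x_Suc: "x (m + 1) = \<Phi> (q * m) y - of_int (p * m)" for m
  proof -
    have "\<Phi> (q * m) y = \<Phi> (q * m) (\<Phi> q s) + of_int (- p)"
      using shift_int[of "q * m" "\<Phi> q s" "- p"] by (simp add: y_def)
    also have "\<Phi> (q * m) (\<Phi> q s) = \<Phi> (q * (m + 1)) s" unfolding add[symmetric] by (simp add: algebra_simps)
    finally show ?thesis by (simp add: x_def algebra_simps)
  qed
  have x_mono: "x m \<le> x n" if "m \<le> n" for m n
    using that
  proof (induction n rule: int_ge_induct)
    case (step i)
    have "x i \<le> x (i + 1)" unfolding x_Suc using \<open>s < y\<close> le[of "q * i" s y] by (simp add: x_def)
    then show ?case using step by simp
  qed simp
  have \<Phi>x: "\<Phi> (q * m + i) s = \<Phi> i (x m) + of_int (p * m)"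
    "\<Phi> (q * m + i) y = \<Phi> i (x (m + 1)) + of_int (p * m)" for m i
  proof -
    have 1: "\<Phi> (q * m) s = x m + of_int (p * m)" by (simp add: x_def)
    have 2: "\<Phi> (q * m) y = x (m + 1) + of_int (p * m)" by (simp add: x_Suc)
    have "\<Phi> (q * m + i) s = \<Phi> i (x m + of_int (p * m))"
      unfolding add.commute[of "q * m"] add 1 ..
    then show "\<Phi> (q * m + i) s = \<Phi> i (x m) + of_int (p * m)" by (simp only: shift_int)
    have "\<Phi> (q * m + i) y = \<Phi> i (x (m + 1) + of_int (p * m))"
      unfolding add.commute[of "q * m"] add 2 ..
    then show "\<Phi> (q * m + i) y = \<Phi> i (x (m + 1)) + of_int (p * m)" by (simp only: shift_int)
  qed
  define N where "N i = {m. \<Phi> i (x (m + 1)) - \<Phi> i (x m) > \<delta>}" for i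
  have fin: "finite (N i)" for i
  proof (rule finite_separated[where a = "\<lambda>m. \<Phi> i (x m)"])
    show "\<delta> > 0" by fact
    show "\<Phi> i \<alpha> \<le> \<Phi> i (x n) \<and> \<Phi> i (x n) \<le> \<Phi> i (\<alpha> + 1)" for n
      using x_lim by (simp add: le)
    have *: "\<Phi> i (x n) - \<Phi> i (x m) \<ge> \<delta>" if "m \<in> N i" "m < n" for m n
    proof -
      have "\<Phi> i (x (m + 1)) \<le> \<Phi> i (x n)" using x_mono[of "m + 1" n] that(2) by (simp add: le)
      then show ?thesis using that(1) by (simp add: N_def)
    qed
    show "\<bar>\<Phi> i (x m) - \<Phi> i (x n)\<bar> \<ge> \<delta>" if "m \<in> N i" "n \<in> N i" "m \<noteq> n" for m n
      using *[of m n] *[of n m] that by (cases "m < n") auto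
  qed
  have "{n. \<Phi> n y - \<Phi> n s > \<delta>} \<subseteq> (\<Union>i\<in>{-\<bar>q\<bar>..\<bar>q\<bar>}. (\<lambda>m. q * m + i) ` N i)"
  proof
    fix n assume n: "n \<in> {n. \<Phi> n y - \<Phi> n s > \<delta>}"
    have eq: "n = q * (n div q) + n mod q" by simp
    have "n div q \<in> N (n mod q)"
      using n \<Phi>x[of "n div q" "n mod q"] unfolding N_def mem_Collect_eq eq[symmetric] by simp
    moreover have "n mod q \<in> {-\<bar>q\<bar>..\<bar>q\<bar>}"
      using abs_mod_less[OF q, of n] by auto
    ultimately show "n \<in> (\<Union>i\<in>{-\<bar>q\<bar>..\<bar>q\<bar>}. (\<lambda>m. q * m + i) ` N i)"
      using eq by blast
  qed
  then have "finite {n. \<Phi> n y - \<Phi> n s > \<delta>}"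
    by (rule finite_subset) (use fin in auto)
  then show ?thesis using close_pair_if_finitely_many_large \<open>s < y\<close> \<open>\<delta> > 0\<close> by blast
qed

text \<open>
  A return map that moves some point to the left is replaced by its inverse. If it moves no point, then
  \<open>\<Phi> n\<close> depends only on \<open>n mod q\<close>, up to a translation, which does not change lengths.
\<close>

lemma close_pair_if_periodic:
  assumes q: "q \<noteq> 0" and \<alpha>: "\<Phi> q \<alpha> = \<alpha> + of_int p" and \<delta>: "\<delta> > 0"
  shows "close_pair \<delta>"
proof -
  consider t where "\<Phi> q t > t + of_int p" | t where "\<Phi> q t < t + of_int p"
    | "\<And>t. \<Phi> q t = t + of_int p"
    by (meson linorder_neqE_linordered_idom)
  then show ?thesis
  proof cases
    case 1 then show ?thesis using close_pair_if_fixed[OF q \<alpha> \<delta>] by blast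
  next
    case 2
    have m: "\<Phi> (- q) u + of_int p = \<Phi> (- q) (u + of_int p)" for u by (simp add: shift_int)
    have "\<Phi> (- q) \<alpha> = \<alpha> + of_int (- p)" using m[of \<alpha>] \<alpha> minus[of q \<alpha>] by simp
    moreover have "\<Phi> (- q) t > t + of_int (- p)"
      using 2 m[of t] minus[of q t] less[of "- q" "\<Phi> q t" "t + of_int p"] by simp
    ultimately show ?thesis using close_pair_if_fixed[of "- q" \<alpha> "- p" \<delta> t] q \<delta> by simp
  next
    case 3
    obtain z :: real where z: "0 < z" "z < 1"
      "\<And>n w. n \<in> {-\<bar>q\<bar>..\<bar>q\<bar>} \<Longrightarrow> 0 \<le> w \<Longrightarrow> w \<le> z \<Longrightarrow> \<Phi> n w - \<Phi> n 0 \<le> \<delta>"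
      by (rule close_on_finite[of "{-\<bar>q\<bar>..\<bar>q\<bar>}" 0 1, OF _ _ \<delta>]) (simp, simp, rule that)
    have "\<bar>\<Phi> n z - \<Phi> n 0\<bar> \<le> \<delta>" for n
    proof -
      have "\<Phi> n t = \<Phi> (n mod q) t + of_int (p * (n div q))" for t
      proof -
        have "\<Phi> n t = \<Phi> (n mod q) (\<Phi> (q * (n div q)) t)"
          unfolding add[symmetric] by simp
        then show ?thesis unfolding power_shift[OF 3] shift_int .
      qed
      moreover have "n mod q \<in> {-\<bar>q\<bar>..\<bar>q\<bar>}" using abs_mod_less[OF q, of n] by auto
      moreover have "\<Phi> (n mod q) 0 < \<Phi> (n mod q) z" using z by (simp add: less)
      ultimately show ?thesis using z(3)[of "n mod q" z] z(1) by simp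
    qed
    then show ?thesis unfolding close_pair_def using z by (intro exI[of _ 0] exI[of _ z]) auto
  qed
qed

text \<open>
  The full preimage in the line of the orbit of the base point on the circle.
\<close>

definition orbit0 :: "real set" where
  "orbit0 = {\<Phi> l 0 + of_int c | l c. True}"

lemma orbit0_closed: "u \<in> orbit0 \<Longrightarrow> \<Phi> n u + of_int c \<in> orbit0"
proof -
  assume "u \<in> orbit0"
  then obtain l d where u: "u = \<Phi> l 0 + of_int d" by (auto simp: orbit0_def)
  have "\<Phi> n u + of_int c = \<Phi> (n + l) 0 + of_int (d + c)" by (simp add: u shift_int add)
  then show ?thesis unfolding orbit0_def by blast
qed

lemma int_in_orbit0: "of_int c \<in> orbit0"
  unfolding orbit0_def using zero[of 0] by (intro CollectI exI[of _ 0] exI[of _ c]) simp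

text \<open>
  Let \<open>\<alpha>\<close> be the last point of the orbit closure before the gap. Iterates and translates of \<open>\<alpha>\<close> lie in
  the orbit closure, which misses the open interval from \<open>\<alpha>\<close> to \<open>b\<close>. Two images of this interval that
  overlap therefore start at the same point, and that would make \<open>\<alpha>\<close> periodic.
\<close>

lemma close_pair_if_gap:
  assumes np: "\<And>q t p. q \<noteq> 0 \<Longrightarrow> \<Phi> q t \<noteq> t + of_int p"
    and "a < b" and gap: "orbit0 \<inter> {a<..<b} = {}" and \<delta>: "\<delta> > 0"
  shows "close_pair \<delta>"
proof -
  define O' where "O' = {u \<in> orbit0. u \<le> a}"
  define \<alpha> where "\<alpha> = Sup O'"
  have ne: "O' \<noteq> {}" using int_in_orbit0[of "\<lfloor>a\<rfloor>"] by (auto simp: O'_def)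
  have bdd: "bdd_above O'" by (auto simp: O'_def bdd_above_def)
  have \<alpha>a: "\<alpha> \<le> a" unfolding \<alpha>_def by (rule cSup_least[OF ne]) (simp add: O'_def)
  have gap': "u \<notin> orbit0" if "\<alpha> < u" "u < b" for u
  proof
    assume u: "u \<in> orbit0"
    with gap that have "u \<le> a" by force
    with u have "u \<le> \<alpha>" unfolding \<alpha>_def by (intro cSup_upper bdd) (simp add: O'_def)
    with that show False by simp
  qed
  have lim: "\<exists>u\<in>orbit0. r < u \<and> u \<le> \<alpha>" if "r < \<alpha>" for r
    using less_cSupD[OF ne, of r] that cSup_upper[OF _ bdd] unfolding \<alpha>_def O'_def by auto
  \<comment> \<open>An image of \<open>\<alpha>\<close> inside the gap would be approximated from the left by orbit points in the gap.\<close>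
  have key: "\<not> (\<alpha> < \<Phi> k \<alpha> + of_int d \<and> \<Phi> k \<alpha> + of_int d < b)" for k d
  proof
    assume A: "\<alpha> < \<Phi> k \<alpha> + of_int d \<and> \<Phi> k \<alpha> + of_int d < b"
    define r where "r = \<Phi> (- k) (\<alpha> - of_int d)"
    have \<Phi>r: "\<Phi> k r = \<alpha> - of_int d" using minus[of "- k" "\<alpha> - of_int d"] by (simp add: r_def)
    have "r < \<alpha>" using A \<Phi>r less[of k r \<alpha>] by simp
    then obtain u where u: "u \<in> orbit0" "r < u" "u \<le> \<alpha>" using lim by blast
    have "\<alpha> < \<Phi> k u + of_int d" using u(2) less[of k r u] \<Phi>r by simp
    moreover have "\<Phi> k u + of_int d < b" using u(3) le[of k u \<alpha>] A by simp
    ultimately show False using gap' orbit0_closed[OF u(1)] by blast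
  qed
  have sep: "\<Phi> n b + of_int c \<le> \<Phi> m \<alpha> + of_int d"
    if "\<Phi> n \<alpha> + of_int c \<le> \<Phi> m \<alpha> + of_int d" "n \<noteq> m" for n m c d
  proof -
    have inv: "\<Phi> n (\<Phi> (m - n) \<alpha> + of_int (d - c)) + of_int c = \<Phi> m \<alpha> + of_int d"
      unfolding shift_int add[symmetric] by simp
    have "\<Phi> n \<alpha> \<le> \<Phi> n (\<Phi> (m - n) \<alpha> + of_int (d - c))" using that(1) inv by simp
    then have "\<alpha> \<le> \<Phi> (m - n) \<alpha> + of_int (d - c)" by (simp only: le)
    moreover have "\<alpha> \<noteq> \<Phi> (m - n) \<alpha> + of_int (d - c)"
      using np[of "m - n" \<alpha> "c - d"] that(2) by auto
    ultimately have "b \<le> \<Phi> (m - n) \<alpha> + of_int (d - c)" using key[of "m - n" "d - c"] by force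
    then have "\<Phi> n b \<le> \<Phi> n (\<Phi> (m - n) \<alpha> + of_int (d - c))" by (simp only: le)
    then show ?thesis using inv by simp
  qed
  have "finite {n. \<Phi> n b - \<Phi> n \<alpha> > \<delta>}"
  proof (rule finite_separated[where a = "\<lambda>n. \<Phi> n \<alpha> + of_int (- \<lfloor>\<Phi> n \<alpha>\<rfloor>)"])
    show "0 \<le> \<Phi> n \<alpha> + of_int (- \<lfloor>\<Phi> n \<alpha>\<rfloor>) \<and> \<Phi> n \<alpha> + of_int (- \<lfloor>\<Phi> n \<alpha>\<rfloor>) \<le> 1" for n
      by simp linarith
    fix m n assume "m \<in> {n. \<Phi> n b - \<Phi> n \<alpha> > \<delta>}" "n \<in> {n. \<Phi> n b - \<Phi> n \<alpha> > \<delta>}" "m \<noteq> n"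
    then show "\<bar>\<Phi> m \<alpha> + of_int (- \<lfloor>\<Phi> m \<alpha>\<rfloor>) - (\<Phi> n \<alpha> + of_int (- \<lfloor>\<Phi> n \<alpha>\<rfloor>))\<bar> \<ge> \<delta>"
      using sep[of n "- \<lfloor>\<Phi> n \<alpha>\<rfloor>" m "- \<lfloor>\<Phi> m \<alpha>\<rfloor>"] sep[of m "- \<lfloor>\<Phi> m \<alpha>\<rfloor>" n "- \<lfloor>\<Phi> n \<alpha>\<rfloor>"]
      by (cases "\<Phi> n \<alpha> + of_int (- \<lfloor>\<Phi> n \<alpha>\<rfloor>) \<le> \<Phi> m \<alpha> + of_int (- \<lfloor>\<Phi> m \<alpha>\<rfloor>)") auto
  qed (rule \<delta>)
  moreover have "\<alpha> < b" using \<alpha>a \<open>a < b\<close> by simp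
  ultimately show ?thesis using close_pair_if_finitely_many_large \<delta> by blast
qed

text \<open>
  Choose orbit points \<open>u k\<close> in the grid intervals of length \<open>1 / K\<close> and a return \<open>y = \<Phi> q 0 + p\<close> so close
  to \<open>0\<close> that each of the finitely many iterates involved maps it to within \<open>1 / K\<close> of the image of \<open>0\<close>.
  By commutation \<open>\<Phi> q + p\<close> then moves each \<open>u k\<close> by at most \<open>1 / K\<close>, and by monotonicity it
  moves every point by at most \<open>3 / K\<close>. Evaluated at \<open>\<Phi> m 0\<close> this bounds \<open>\<Phi> m y - \<Phi> m 0\<close>.
\<close>

lemma close_pair_if_dense:
  assumes dense: "\<And>a b. a < b \<Longrightarrow> orbit0 \<inter> {a<..<b} \<noteq> {}" and \<delta>: "\<delta> > 0"
  shows "close_pair \<delta>"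
proof -
  obtain K0 :: nat where K0: "3 / \<delta> < real K0" using reals_Archimedean2 by blast
  define K where "K = int K0"
  have K: "K > 0" "3 / of_int K < \<delta>"
  proof -
    have "real K0 > 0" using K0 \<delta> by (meson divide_pos_pos less_trans zero_less_numeral)
    then show "K > 0" "3 / of_int K < \<delta>" using K0 \<delta> by (auto simp: K_def field_simps)
  qed
  have "\<exists>l c. of_int k / of_int K < \<Phi> l 0 + of_int c \<and> \<Phi> l 0 + of_int c < of_int (k + 1) / of_int K" for k
    using dense[of "of_int k / of_int K" "of_int (k + 1) / of_int K"] K(1)
    by (auto simp: orbit0_def divide_strict_right_mono)
  then obtain l c where lc: "\<And>k. of_int k / of_int K < \<Phi> (l k) 0 + of_int (c k)"
    "\<And>k. \<Phi> (l k) 0 + of_int (c k) < of_int (k + 1) / of_int K" by metis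
  define u where "u k = \<Phi> (l k) 0 + of_int (c k)" for k
  \<comment> \<open>The indices run one step beyond the unit interval on both sides, so that each of its points lies
    between two of the \<open>u k\<close>.\<close>
  obtain z :: real where z: "0 < z" "z < 1"
      "\<And>n w. n \<in> l ` {-1..K} \<Longrightarrow> 0 \<le> w \<Longrightarrow> w \<le> z \<Longrightarrow> \<Phi> n w - \<Phi> n 0 \<le> 1 / of_int K"
    by (rule close_on_finite[of "l ` {-1..K}" 0 1 "1 / of_int K"]) (simp, simp, use K(1) in simp, rule that)
  obtain y where "y \<in> orbit0" and y: "0 < y" "y < z" using dense[OF z(1)] by auto
  then obtain q p where yqp: "y = \<Phi> q 0 + of_int p" by (auto simp: orbit0_def)
  have ret: "u k \<le> \<Phi> q (u k) + of_int p \<and> \<Phi> q (u k) + of_int p \<le> u k + 1 / of_int K"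
    if "k \<in> {-1..K}" for k
  proof -
    have "\<Phi> q (u k) + of_int p = \<Phi> (l k) (\<Phi> q 0 + of_int p) + of_int (c k)"
      by (simp add: u_def shift_int commute[of q])
    then have "\<Phi> q (u k) + of_int p - u k = \<Phi> (l k) y - \<Phi> (l k) 0" by (simp add: yqp u_def)
    moreover have "\<Phi> (l k) 0 < \<Phi> (l k) y" using y by (simp add: less)
    moreover have "\<Phi> (l k) y - \<Phi> (l k) 0 \<le> 1 / of_int K"
      using z(3)[of "l k" y] that y by simp
    ultimately show ?thesis by simp
  qed
  have near0: "\<bar>\<Phi> q x + of_int p - x\<bar> \<le> \<delta>" if "0 \<le> x" "x < 1" for x
  proof -
    define k where "k = \<lfloor>x * of_int K\<rfloor>"
    have k: "of_int k \<le> x * of_int K" "x * of_int K < of_int k + 1" by (auto simp: k_def)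
    have "0 \<le> k" using that K(1) by (simp add: k_def)
    have "x * of_int K < of_int K" using that K(1) by simp
    then have "k < K" using k(1) by linarith
    define e :: real where "e = 1 / of_int K"
    have eK: "e * of_int K = 1" "e > 0" using K(1) by (auto simp: e_def)
    have ud: "of_int j * e < u j" "u j < of_int j * e + e" for j
      using lc[of j] by (auto simp: u_def e_def add_divide_distrib)
    have kx: "of_int k * e \<le> x" "x < of_int k * e + e"
      using k K(1) by (auto simp: e_def field_simps)
    have "x \<le> u (k + 1)" using ud(1)[of "k + 1"] kx by (simp add: algebra_simps)
    then have "\<Phi> q x + of_int p \<le> \<Phi> q (u (k + 1)) + of_int p" by (simp add: le)
    also have "\<dots> \<le> u (k + 1) + e" using ret[of "k + 1"] \<open>0 \<le> k\<close> \<open>k < K\<close> by (simp add: e_def)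
    also have "\<dots> \<le> x + 3 * e" using ud(2)[of "k + 1"] kx by (simp add: algebra_simps)
    finally have up: "\<Phi> q x + of_int p \<le> x + 3 * e" .
    have "u (k - 1) \<le> x" using ud(2)[of "k - 1"] kx by (simp add: algebra_simps)
    then have "\<Phi> q x + of_int p \<ge> \<Phi> q (u (k - 1)) + of_int p" by (simp add: le)
    moreover have "\<Phi> q (u (k - 1)) + of_int p \<ge> u (k - 1)" using ret[of "k - 1"] \<open>0 \<le> k\<close> \<open>k < K\<close> by simp
    moreover have "u (k - 1) \<ge> x - 2 * e" using ud(1)[of "k - 1"] kx by (simp add: algebra_simps)
    ultimately have "\<Phi> q x + of_int p \<ge> x - 2 * e" by simp
    moreover have "3 * e < \<delta>" using K(2) by (simp add: e_def)
    ultimately show ?thesis using up eK(2) by simp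
  qed
  have near: "\<bar>\<Phi> q x + of_int p - x\<bar> \<le> \<delta>" for x
  proof -
    have "\<Phi> q (x - of_int \<lfloor>x\<rfloor>) = \<Phi> q x - of_int \<lfloor>x\<rfloor>"
      using shift_int[of q "x - of_int \<lfloor>x\<rfloor>" "\<lfloor>x\<rfloor>"] by simp
    then show ?thesis using near0[of "x - of_int \<lfloor>x\<rfloor>"] by (simp add: algebra_simps) linarith
  qed
  have "\<bar>\<Phi> m y - \<Phi> m 0\<bar> \<le> \<delta>" for m
    using near[of "\<Phi> m 0"] by (simp add: yqp shift_int commute[of m])
  then show ?thesis unfolding close_pair_def using y z(2) by (intro exI[of _ 0] exI[of _ y]) auto
qed

theorem close_pair_exists: "\<delta> > 0 \<Longrightarrow> close_pair \<delta>"
  using close_pair_if_periodic close_pair_if_gap close_pair_if_dense by metis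

end

section \<open>Circle homeomorphisms are not expansive\<close>

lemma int_iterate_add_1:
  assumes "bij F"
  shows "int_iterate UNIV F (m + 1) t = F (int_iterate UNIV F m t)"
proof (cases "m \<ge> 0")
  case True
  then show ?thesis by (simp add: int_iterate_def nat_add_distrib)
next
  case False
  define k where "k = nat (- m - 1)"
  have k: "m = - int (Suc k)" using False by (simp add: k_def)
  have "F (inv F x) = x" for x using assms by (simp add: bij_is_surj surj_f_inv_f)
  then show ?thesis by (cases k) (auto simp: int_iterate_def k nat_add_distrib)
qed

lemma int_iterate_diff_1:
  assumes "bij F"
  shows "int_iterate UNIV F (m - 1) t = inv F (int_iterate UNIV F m t)"
  using int_iterate_add_1[OF assms, of "m - 1" t] assms by (simp add: bij_is_inj)

lemma int_iterate_add:
  assumes "bij F"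
  shows "int_iterate UNIV F (m + n) t = int_iterate UNIV F m (int_iterate UNIV F n t)"
proof (induction m rule: int_induct[where k = 0])
  case base show ?case by (simp add: int_iterate_def)
next
  case (step1 i)
  then show ?case using int_iterate_add_1[OF assms] by (metis add.assoc add.commute)
next
  case (step2 i)
  then show ?case using int_iterate_diff_1[OF assms] by (metis diff_add_eq)
qed

text \<open>
  The inverse used for negative iterates is taken in \<open>X\<close> on one side and on the whole line on the
  other; both match along \<open>e\<close> because \<open>f\<close> is injective on \<open>X\<close>.
\<close>

lemma int_iterate_semiconj:
  assumes eX: "\<And>t. e t \<in> X" and f: "inj_on f X" and F: "bij F" and eF: "\<And>t. e (F t) = f (e t)"
  shows "e (int_iterate UNIV F m t) = int_iterate X f m (e t)"
proof -
  have "e (inv F t) = inv_into X f (e t)" for t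
  proof -
    have "e t = f (e (inv F t))" using F by (metis bij_is_surj eF surj_f_inv_f)
    then show ?thesis using f eX by simp
  qed
  then have "e ((inv F ^^ n) t) = (inv_into X f ^^ n) (e t)" for n by (induction n) simp_all
  moreover have "e ((F ^^ n) t) = (f ^^ n) (e t)" for n by (induction n) (simp_all add: eF)
  ultimately show ?thesis by (simp add: int_iterate_def)
qed

lemma continuous_Ints_constant:
  fixes h :: "real \<Rightarrow> real"
  assumes "continuous_on UNIV h" "\<And>t. h t \<in> \<int>"
  shows "\<exists>k. \<forall>t. h t = of_int k"
proof -
  have "h constant_on UNIV"
  proof (rule continuous_discrete_range_constant[OF connected_UNIV assms(1)])
    fix x
    have "1 \<le> norm (h y - h x)" if "h y \<noteq> h x" for y
    proof -
      obtain a b where "h x = of_int a" "h y = of_int b" using assms(2) Ints_cases by metis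
      then show ?thesis using that by simp
    qed
    then show "\<exists>e>0. \<forall>y. y \<in> UNIV \<and> h y \<noteq> h x \<longrightarrow> e \<le> norm (h y - h x)"
      using zero_less_one by blast
  qed
  then show ?thesis using assms(2) unfolding constant_on_def by (metis Ints_cases UNIV_I)
qed

text \<open>
  A covering of a circle of length one by the line, given by its fibres. Only the image of \<open>e\<close> is the
  circle, so the ambient space can be larger, such as a sphere that contains it.
\<close>

locale circle_cover =
  fixes e :: "real \<Rightarrow> 'a::metric_space" and L :: real
  assumes fibre: "e s = e t \<longleftrightarrow> t - s \<in> \<int>"
    and lipschitz: "dist (e s) (e t) \<le> L * \<bar>s - t\<bar>" and L_pos: "L > 0"
begin

text \<open>
  The integer \<open>d\<close> is the degree of the circle map that \<open>H\<close> lifts.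
\<close>

lemma lift_shift:
  assumes cont: "continuous_on UNIV H" and resp: "\<And>s t. e s = e t \<Longrightarrow> e (H s) = e (H t)"
  shows "\<exists>d. \<forall>t k. H (t + of_int k) = H t + of_int (d * k)"
proof -
  have "\<exists>d. \<forall>t. H (t + 1) - H t = of_int d"
  proof (rule continuous_Ints_constant)
    show "continuous_on UNIV (\<lambda>t. H (t + 1) - H t)"
      by (intro continuous_intros continuous_on_compose2[OF cont]) auto
    show "H (t + 1) - H t \<in> \<int>" for t
      using resp[of t "t + 1"] by (simp add: fibre)
  qed
  then obtain d where "\<And>t. H (t + 1) - H t = of_int d" by blast
  then have d: "H (t + 1) = H t + of_int d" for t by (metis diff_add_cancel add.commute)
  have "H (t + of_int k) = H t + of_int (d * k)" for t k
  proof (induction k rule: int_induct[where k = 0])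
    case (step1 i)
    then show ?case using d[of "t + of_int i"] by (simp add: algebra_simps)
  next
    case (step2 i)
    then show ?case using d[of "t + of_int (i - 1)"] by (simp add: algebra_simps)
  qed simp
  then show ?thesis by blast
qed

lemma strict_mono_square:
  fixes H :: "real \<Rightarrow> real"
  assumes "continuous_on UNIV H" "inj H"
  shows "strict_mono (\<lambda>t. H (H t))"
proof -
  have "strict_mono H \<or> strict_antimono_on UNIV H"
    using injective_eq_monotone_map[of UNIV H] assms by simp
  then show ?thesis by (auto simp: monotone_on_def)
qed

text \<open>
  Correcting the lift of the inverse by a translation gives a true inverse of \<open>F\<close>. The degrees of
  \<open>\<Phi> m\<close> and \<open>\<Phi> (- m)\<close> multiply to one, so \<open>\<Phi> (2 * m) = \<Phi> m \<circ> \<Phi> m\<close> is increasing of degree one even if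
  \<open>f\<close> reverses the orientation. A close pair for the even iterates remains close under the odd ones by
  uniform continuity of \<open>f\<close>.
\<close>

theorem not_expansive_if_lifts:
  assumes "compact X" and eX: "\<And>t. e t \<in> X" and hom: "homeomorphism X X f g"
    and F: "continuous_on UNIV F" "\<And>t. e (F t) = f (e t)"
    and G0: "continuous_on UNIV G0" "\<And>t. e (G0 t) = g (e t)"
  shows "\<not> expansive_on X f"
proof
  have gf: "g (f x) = x" and fg: "f (g x) = x" if "x \<in> X" for x
    using hom that by (auto simp: homeomorphism_def)
  have "\<exists>k. \<forall>t. F (G0 t) - t = of_int k"
  proof (rule continuous_Ints_constant)
    show "continuous_on UNIV (\<lambda>t. F (G0 t) - t)"
      by (intro continuous_intros continuous_on_compose2[OF F(1)] G0(1)) auto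
    have "e t = e (F (G0 t))" for t by (simp add: F G0 fg eX)
    then show "F (G0 t) - t \<in> \<int>" for t by (simp only: fibre)
  qed
  then obtain k where k: "\<And>t. F (G0 t) - t = of_int k" by blast
  define G where "G t = G0 (t - of_int k)" for t
  have contG: "continuous_on UNIV G"
    unfolding G_def by (intro continuous_intros continuous_on_compose2[OF G0(1)]) auto
  have FG: "F (G t) = t" for t using k[of "t - of_int k"] by (simp add: G_def)
  have eG: "e (G t) = g (e t)" for t
  proof -
    have "e (t - of_int k) = e t" by (simp add: fibre)
    then show ?thesis by (simp add: G_def G0)
  qed
  have "\<exists>k. \<forall>t. G (F t) - t = of_int k"
  proof (rule continuous_Ints_constant)
    show "continuous_on UNIV (\<lambda>t. G (F t) - t)"
      by (intro continuous_intros continuous_on_compose2[OF contG] F(1)) auto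
    have "e t = e (G (F t))" for t by (simp add: F eG gf eX)
    then show "G (F t) - t \<in> \<int>" for t by (simp only: fibre)
  qed
  then obtain k' where "\<And>t. G (F t) - t = of_int k'" by blast
  then have "inj F" by (intro injI) (metis diff_left_imp_eq)
  then have GF: "G (F t) = t" for t using FG[of "F t"] by (simp add: inj_eq)
  have bij: "bij F" by (rule bijI'[OF inj_eq[OF \<open>inj F\<close>]]) (metis FG)
  have inv: "inv F = G" using GF FG by (intro inv_equality)
  define \<Phi> where "\<Phi> = int_iterate UNIV F"
  have add: "\<Phi> (m + n) t = \<Phi> m (\<Phi> n t)" for m n t
    unfolding \<Phi>_def by (rule int_iterate_add[OF bij])
  have zero: "\<Phi> 0 t = t" for t by (simp add: \<Phi>_def int_iterate_def)
  have funpow_cont: "continuous_on UNIV (H ^^ n)" if "continuous_on UNIV H" for n and H :: "real \<Rightarrow> real"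
    by (induction n) (auto intro!: continuous_intros continuous_on_compose2[OF that] simp: comp_def id_def)
  have cont: "continuous_on UNIV (\<Phi> m)" for m
    unfolding \<Phi>_def int_iterate_def inv using funpow_cont F(1) contG by simp
  have semi: "e (\<Phi> m t) = int_iterate X f m (e t)" for m t
    unfolding \<Phi>_def
  proof (rule int_iterate_semiconj)
    show "inj_on f X" by (metis gf inj_onI)
  qed (simp_all add: eX bij F(2))
  have inv_\<Phi>: "\<Phi> m (\<Phi> (- m) t) = t" "\<Phi> (- m) (\<Phi> m t) = t" for m t
    using add[of m "- m" t] add[of "- m" m t] zero by simp_all
  have "\<exists>d. \<forall>t k. \<Phi> m (t + of_int k) = \<Phi> m t + of_int (d * k)" for m
    by (rule lift_shift[OF cont]) (simp add: semi)
  then obtain d where d: "\<And>m t k. \<Phi> m (t + of_int k) = \<Phi> m t + of_int (d m * k)" by metis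
  have dd: "d m * d m = 1" for m
  proof -
    have "0 + of_int 1 = \<Phi> m (\<Phi> (- m) (0 + of_int 1))" by (simp only: inv_\<Phi>)
    also have "\<dots> = 0 + of_int (d m * (d (- m) * 1))" by (simp only: d inv_\<Phi>)
    finally have "real_of_int (d m * d (- m)) = 1" by simp
    then have "d m * d (- m) = 1" by (simp only: of_int_eq_1_iff)
    then have "\<bar>d m\<bar> = 1" by (metis abs_zmult_eq_1 abs_one)
    then show ?thesis by (metis abs_mult_self_eq mult_1)
  qed
  have double: "\<Phi> (2 * m) t = \<Phi> m (\<Phi> m t)" for m t by (simp flip: add)
  interpret circle_lift_action "\<lambda>m. \<Phi> (2 * m)"
  proof
    show "strict_mono (\<Phi> (2 * m))" for m
    proof -
      have "inj (\<Phi> m)" by (rule injI) (metis inv_\<Phi>(2))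
      then show ?thesis using strict_mono_square[OF cont[of m]] by (simp flip: double)
    qed
    show "isCont (\<Phi> (2 * m)) t" for m t
      using cont[of "2 * m"] by (simp add: continuous_on_eq_continuous_at)
    show "\<Phi> (2 * m) (t + 1) = \<Phi> (2 * m) t + 1" for m t
      using d[of m t 1] d[of m "\<Phi> m t" "d m"] by (simp add: double dd)
    show "\<Phi> (2 * (m + n)) t = \<Phi> (2 * m) (\<Phi> (2 * n) t)" for m n t
      by (simp add: distrib_left add)
  qed (simp add: zero)
  assume "expansive_on X f"
  then obtain \<delta> where "\<delta> > 0" and
    sep: "\<And>x y. x \<in> X \<Longrightarrow> y \<in> X \<Longrightarrow> x \<noteq> y \<Longrightarrow>
      \<exists>m. dist (int_iterate X f m x) (int_iterate X f m y) > \<delta>"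
    unfolding expansive_on_def by blast
  have "uniformly_continuous_on X f"
    using hom \<open>compact X\<close> by (intro compact_uniformly_continuous) (auto simp: homeomorphism_def)
  then obtain \<eta> where "\<eta> > 0" and \<eta>: "\<And>x y. x \<in> X \<Longrightarrow> y \<in> X \<Longrightarrow> dist x y < \<eta> \<Longrightarrow> dist (f x) (f y) < \<delta>"
    unfolding uniformly_continuous_on_def using \<open>\<delta> > 0\<close> by metis
  define \<rho> where "\<rho> = min \<delta> \<eta> / 2"
  have \<rho>: "\<rho> > 0" "\<rho> \<le> \<delta>" "\<rho> < \<eta>" using \<open>\<delta> > 0\<close> \<open>\<eta> > 0\<close> by (auto simp: \<rho>_def)
  obtain x y where xy: "x < y" "y < x + 1" and close: "\<And>m. \<bar>\<Phi> (2 * m) y - \<Phi> (2 * m) x\<bar> \<le> \<rho> / L"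
    using close_pair_exists[of "\<rho> / L"] \<rho>(1) L_pos unfolding close_pair_def by auto
  have near: "dist (e (\<Phi> (2 * m) x)) (e (\<Phi> (2 * m) y)) \<le> \<rho>" for m
  proof -
    have "L * \<bar>\<Phi> (2 * m) x - \<Phi> (2 * m) y\<bar> \<le> \<rho>"
      using close[of m] L_pos by (simp add: field_simps abs_minus_commute)
    then show ?thesis using lipschitz order_trans by blast
  qed
  have "dist (e (\<Phi> n x)) (e (\<Phi> n y)) \<le> \<delta>" for n
  proof (cases "even n")
    case True
    then obtain m where "n = 2 * m" by blast
    then show ?thesis using near[of m] \<rho> by simp
  next
    case False
    then obtain m where m: "n = 2 * m + 1" by (rule oddE)
    have "\<Phi> n t = F (\<Phi> (2 * m) t)" for t
      unfolding m \<Phi>_def by (rule int_iterate_add_1[OF bij])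
    then show ?thesis using \<eta>[of "e (\<Phi> (2 * m) x)" "e (\<Phi> (2 * m) y)"] near[of m] \<rho> eX
      by (simp add: F(2))
  qed
  then have "\<not> dist (int_iterate X f m (e x)) (int_iterate X f m (e y)) > \<delta>" for m
    by (simp add: semi not_less)
  moreover have "e x \<noteq> e y"
  proof
    assume "e x = e y"
    then obtain c where "y - x = of_int c" by (auto simp: fibre elim: Ints_cases)
    then have "0 < real_of_int c" "real_of_int c < 1" using xy by auto
    then show False by simp
  qed
  ultimately show False using sep eX by blast
qed

end

section \<open>Invariant planes of linear maps\<close>

text \<open>
  The vector \<open>p(T) v\<close>.
\<close>

definition poly_op :: "('a::real_vector \<Rightarrow> 'a) \<Rightarrow> real poly \<Rightarrow> 'a \<Rightarrow> 'a" where
  "poly_op T p v = (\<Sum>i\<le>degree p. coeff p i *\<^sub>R (T ^^ i) v)"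

lemma poly_op_eq: "degree p \<le> n \<Longrightarrow> poly_op T p v = (\<Sum>i\<le>n. coeff p i *\<^sub>R (T ^^ i) v)"
  unfolding poly_op_def by (rule sum.mono_neutral_left) (auto simp: coeff_eq_0)

lemma poly_op_0 [simp]: "poly_op T 0 v = 0"
  by (simp add: poly_op_def)

context
  fixes T :: "'a::real_vector \<Rightarrow> 'a"
  assumes T: "linear T"
begin

lemma poly_op_pCons [simp]: "poly_op T (pCons a p) v = a *\<^sub>R v + T (poly_op T p v)"
proof -
  have "poly_op T (pCons a p) v = (\<Sum>i\<le>Suc (degree p). coeff (pCons a p) i *\<^sub>R (T ^^ i) v)"
    by (rule poly_op_eq) (rule degree_pCons_le)
  then show ?thesis
    by (simp add: sum.atMost_Suc_shift poly_op_def linear_sum[OF T] linear_scale[OF T] del: sum.atMost_Suc)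
qed

lemma poly_op_add: "poly_op T (p + q) v = poly_op T p v + poly_op T q v"
  by (induction p q rule: poly_induct2) (simp_all add: linear_add[OF T] algebra_simps)

lemma poly_op_smult: "poly_op T (smult a p) v = a *\<^sub>R poly_op T p v"
  by (induction p) (simp_all add: linear_scale[OF T] algebra_simps)

lemma poly_op_commute: "poly_op T p (a *\<^sub>R v + T w) = a *\<^sub>R poly_op T p v + T (poly_op T p w)"
  by (induction p) (simp_all add: linear_add[OF T] linear_scale[OF T] linear_0[OF T] algebra_simps)

lemma poly_op_zero_vec: "poly_op T p 0 = 0"
  by (induction p) (simp_all add: linear_0[OF T])

lemma poly_op_mult: "poly_op T (p * q) v = poly_op T q (poly_op T p v)"
  by (induction p) (simp_all add: poly_op_zero_vec poly_op_add poly_op_smult poly_op_commute)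

end

lemma real_poly_factor:
  fixes p :: "real poly"
  assumes "degree p > 0"
  obtains c where "[:c, 1:] dvd p" | b c where "[:c, b, 1:] dvd p"
proof -
  let ?P = "map_poly complex_of_real p"
  have "degree ?P > 0" using assms by (simp add: degree_map_poly)
  then have "\<not> constant (poly ?P)" by (simp add: constant_degree)
  then obtain z where z: "poly ?P z = 0" using fundamental_theorem_of_algebra by blast
  have lin: "linear ((*) z)" by (rule bounded_linear.linear[OF bounded_linear_mult_right])
  \<comment> \<open>Multiplication by \<open>z\<close> is a real-linear map of the complex numbers, and applying \<open>q\<close> of this map
    to \<open>1\<close> is evaluation at \<open>z\<close>.\<close>
  have ev: "poly_op ((*) z) q 1 = poly (map_poly complex_of_real q) z" for q
    by (induction q) (simp_all add: lin map_poly_pCons scaleR_conv_of_real)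
  show ?thesis
  proof (cases "Im z = 0")
    case True
    have "of_real (poly q x) = poly (map_poly complex_of_real q) (of_real x)" for q x
      by (induction q) (simp_all add: map_poly_pCons)
    then have "of_real (poly p (Re z)) = poly ?P (of_real (Re z))" .
    also have "of_real (Re z) = z" using True by (simp add: complex_eq_iff)
    finally have "poly p (Re z) = 0" using z by simp
    then show ?thesis using that(1)[of "- Re z"] by (simp add: poly_eq_0_iff_dvd)
  next
    case False
    define d where "d = [:(cmod z)\<^sup>2, -2 * Re z, 1:]"
    define r where "r = p mod d"
    have "degree r < 2" using degree_mod_less'[of d p] by (cases "r = 0") (auto simp: r_def d_def)
    then obtain r0 r1 where r: "r = [:r0, r1:]"
      by (cases r; rename_tac a s; case_tac s) (auto split: if_splits)
    have d0: "poly_op ((*) z) d 1 = 0"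
      by (simp add: d_def lin complex_eq_iff cmod_power2) (simp add: power2_eq_square algebra_simps)
    have "p = d * (p div d) + r" by (simp add: r_def)
    then have "poly_op ((*) z) r 1 = 0"
      using z d0 by (metis add_0 ev lin poly_op_add poly_op_mult poly_op_zero_vec)
    then have "r0 + r1 * Re z = 0" "r1 * Im z = 0" by (auto simp: r lin complex_eq_iff)
    then have "r = 0" using False r by simp
    then show ?thesis using that(2) by (simp add: r_def d_def mod_eq_0_iff_dvd)
  qed
qed

text \<open>
  The vectors \<open>v, T v, T\<^sup>2 v, \<dots>\<close> are more than the dimension allows to be independent. A repetition
  among them has to be treated separately because it is invisible to the set of these vectors.
\<close>

lemma annihilating_poly:
  fixes T :: "'a::euclidean_space \<Rightarrow> 'a"
  obtains p where "p \<noteq> 0" "poly_op T p v = 0"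
proof (cases "inj_on (\<lambda>i. (T ^^ i) v) {..DIM('a)}")
  case False
  then obtain i j where ij: "(T ^^ i) v = (T ^^ j) v" "i \<noteq> j" by (auto simp: inj_on_def)
  let ?p = "monom 1 i - monom 1 j :: real poly"
  have "coeff ?p i \<noteq> coeff 0 i" using ij by simp
  then have "?p \<noteq> 0" by metis
  moreover have "degree ?p \<le> max i j"
    by (rule order.trans[OF degree_diff_le_max]) (simp add: degree_monom_eq)
  then have "poly_op T ?p v = (\<Sum>k\<le>max i j. coeff ?p k *\<^sub>R (T ^^ k) v)" by (rule poly_op_eq)
  then have "poly_op T ?p v = 0"
    using ij by (simp add: scaleR_diff_left sum_subtractf if_distrib[of "\<lambda>c. c *\<^sub>R _"] cong: if_cong)
  ultimately show ?thesis by (rule that)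
next
  case True
  let ?S = "(\<lambda>i. (T ^^ i) v) ` {..DIM('a)}"
  have "card ?S > DIM('a)" using card_image[OF True] by simp
  then have "dependent ?S" by (intro dependent_biggerset) simp
  then obtain u where u: "\<exists>x\<in>?S. u x \<noteq> 0" "(\<Sum>x\<in>?S. u x *\<^sub>R x) = 0"
    by (auto simp: dependent_finite)
  define p where "p = (\<Sum>i\<le>DIM('a). monom (u ((T ^^ i) v)) i)"
  have co: "coeff p k = (if k \<le> DIM('a) then u ((T ^^ k) v) else 0)" for k
    by (simp add: p_def coeff_sum)
  have "p \<noteq> 0" using u(1) co by (metis (no_types, lifting) atMost_iff coeff_0 imageE)
  moreover have "poly_op T p v = 0"
  proof -
    have "degree p \<le> DIM('a)" by (rule degree_le) (simp add: co)
    then show ?thesis using u(2) by (simp add: poly_op_eq co sum.reindex[OF True])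
  qed
  ultimately show ?thesis by (rule that)
qed

text \<open>
  Peel factors of degree one or two off \<open>p\<close> and apply them to \<open>v\<close> one after the other. The last vector
  outside \<open>U\<close> is the required \<open>w\<close>; a linear relation is turned into a quadratic one by applying \<open>T\<close>.
\<close>

lemma quadratic_relation_mod_subspace:
  fixes T :: "'a::real_vector \<Rightarrow> 'a"
  assumes T: "linear T" and U: "subspace U" and TU: "\<And>u. u \<in> U \<Longrightarrow> T u \<in> U"
    and "v \<notin> U" "p \<noteq> 0" "poly_op T p v \<in> U"
  shows "\<exists>w b c. w \<notin> U \<and> T (T w) + b *\<^sub>R T w + c *\<^sub>R w \<in> U"
  using assms(4-)
proof (induction "degree p" arbitrary: p v rule: less_induct)
  case less
  show ?case
  proof (cases "degree p = 0")
    case True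
    then obtain a where p: "p = [:a:]" using degree_eq_zeroE by blast
    then have "a \<noteq> 0" "a *\<^sub>R v \<in> U" using less.prems by (auto simp: T linear_0)
    then have "v \<in> U" using U by (metis subspace_scale scaleR_scaleR left_inverse scaleR_one)
    then show ?thesis using less.prems by simp
  next
    case False
    have step: ?thesis if d: "d dvd p" "degree d > 0"
      and ex: "poly_op T d v \<in> U \<Longrightarrow> ?thesis" for d
    proof (cases "poly_op T d v \<in> U")
      case v: False
      obtain q where p: "p = d * q" using d(1) by blast
      then have "q \<noteq> 0" "d \<noteq> 0" using less.prems(2) by auto
      then have "degree q < degree p" using d(2) by (simp add: p degree_mult_eq)
      moreover have "poly_op T q (poly_op T d v) \<in> U"
        using less.prems(3) by (simp add: p poly_op_mult[OF T])
      ultimately show ?thesis using less.hyps v \<open>q \<noteq> 0\<close> by blast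
    qed (rule ex)
    from False have "degree p > 0" by simp
    then show ?thesis
    proof (cases rule: real_poly_factor)
      case (1 c)
      show ?thesis
      proof (rule step[OF 1])
        assume "poly_op T [:c, 1:] v \<in> U"
        then have "c *\<^sub>R v + T v \<in> U" by (simp add: T linear_0)
        then have "T (c *\<^sub>R v + T v) \<in> U" by (rule TU)
        then have "T (T v) + c *\<^sub>R T v + 0 *\<^sub>R v \<in> U"
          by (simp add: linear_add[OF T] linear_scale[OF T] add.commute)
        then show ?thesis using less.prems(1) by blast
      qed simp
    next
      case (2 b c)
      show ?thesis
      proof (rule step[OF 2])
        assume "poly_op T [:c, b, 1:] v \<in> U"
        then have "T (T v) + b *\<^sub>R T v + c *\<^sub>R v \<in> U"
          by (simp add: T linear_0 linear_add linear_scale add_ac)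
        then show ?thesis using less.prems(1) by blast
      qed simp
    qed
  qed
qed

lemma span_pair_invariant:
  fixes T :: "'a::euclidean_space \<Rightarrow> 'a"
  assumes T: "linear T" and "x \<noteq> 0" "y \<notin> span {x}" "T x \<in> span {x, y}" "T y \<in> span {x, y}"
  shows "\<exists>P. subspace P \<and> dim P = 2 \<and> T ` P \<subseteq> P"
proof (intro exI conjI)
  have "x \<noteq> y" using assms(3) by (auto intro: span_base)
  have "independent {y, x}" using assms by (simp add: independent_insert)
  then show "dim (span {x, y}) = 2"
    using \<open>x \<noteq> y\<close> by (simp add: dim_eq_card_independent insert_commute)
  have "T ` span {x, y} = span {T x, T y}" using linear_span_image[OF T, of "{x, y}"] by simp
  also have "\<dots> \<subseteq> span {x, y}" using assms by (intro span_minimal) auto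
  finally show "T ` span {x, y} \<subseteq> span {x, y}" .
qed simp

text \<open>
  Take \<open>u \<noteq> 0\<close> with a quadratic relation. Either \<open>u\<close> and \<open>T u\<close> span an invariant plane, or
  \<open>T u = l u\<close>. In the second case take \<open>w\<close> outside the line of \<open>u\<close> with a quadratic relation
  modulo that line. Either \<open>T w\<close> lies in the span of \<open>u\<close> and \<open>w\<close>, or \<open>w' = (T - l) w\<close> is outside
  the line of \<open>u\<close>. Applying \<open>T - l\<close> to the relation of \<open>w\<close> kills its right-hand side, so \<open>w'\<close>
  satisfies a genuine quadratic relation, and either \<open>w'\<close> and \<open>T w'\<close> span the plane or \<open>w'\<close> is a
  second eigenvector.
\<close>

theorem invariant_plane:
  fixes T :: "'a::euclidean_space \<Rightarrow> 'a"
  assumes T: "linear T" and D: "DIM('a) \<ge> 2"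
  shows "\<exists>P. subspace P \<and> dim P = 2 \<and> T ` P \<subseteq> P"
proof -
  have quad: "\<exists>w b c. w \<notin> U \<and> T (T w) + b *\<^sub>R T w + c *\<^sub>R w \<in> U"
    if U: "subspace U" "\<And>u. u \<in> U \<Longrightarrow> T u \<in> U" "v \<notin> U" for U v
  proof -
    obtain p where "p \<noteq> 0" "poly_op T p v = 0" by (rule annihilating_poly)
    then show ?thesis
      using quadratic_relation_mod_subspace[OF T U, of p] subspace_0[OF U(1)] by simp
  qed
  have plane_of_quad: ?thesis
    if w: "w \<noteq> 0" "T (T w) + b *\<^sub>R T w + c *\<^sub>R w = 0" "T w \<notin> span {w}" for w b c
  proof (rule span_pair_invariant[OF T w(1,3)])
    have "T (T w) = (- c) *\<^sub>R w + (- b) *\<^sub>R T w" using w(2) by (simp add: algebra_simps add_eq_0_iff)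
    then show "T (T w) \<in> span {w, T w}" by (simp add: span_add span_diff span_neg span_scale span_base)
  qed (simp add: span_base)
  obtain e :: 'a where e: "e \<in> Basis" by (meson nonempty_Basis ex_in_conv)
  then have "e \<notin> {0}" using nonzero_Basis by auto
  then obtain u b c where u: "u \<noteq> 0" "T (T u) + b *\<^sub>R T u + c *\<^sub>R u = 0"
    using quad[of "{0}" e] linear_0[OF T] by auto
  show ?thesis
  proof (cases "T u \<in> span {u}")
    case False then show ?thesis using plane_of_quad u by blast
  next
    case True
    then obtain l where l: "T u = l *\<^sub>R u" by (auto simp: span_singleton)
    have inv: "T x \<in> span {u}" if "x \<in> span {u}" for x
      using that l by (auto simp: span_singleton linear_scale[OF T])
    have "span {u} \<noteq> UNIV"
    proof
      assume "span {u} = UNIV"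
      then have "DIM('a) = dim {u}" by (metis dim_span dim_UNIV)
      also have "\<dots> \<le> 1" using dim_le_card'[of "{u}"] by simp
      finally show False using D by simp
    qed
    then obtain v where "v \<notin> span {u}" by blast
    from quad[OF subspace_span inv this] obtain w b c
      where w: "w \<notin> span {u}" and q: "T (T w) + b *\<^sub>R T w + c *\<^sub>R w \<in> span {u}" by blast
    show ?thesis
    proof (cases "T w \<in> span {u, w}")
      case True
      then show ?thesis using span_pair_invariant[OF T u(1) w] l by (simp add: span_base span_scale)
    next
      case False
      define w' where "w' = T w - l *\<^sub>R w"
      have w': "w' \<notin> span {u}"
      proof
        assume "w' \<in> span {u}"
        then have "w' \<in> span {u, w}" using span_mono[of "{u}" "{u, w}"] by auto
        then have "w' + l *\<^sub>R w \<in> span {u, w}" by (rule span_add) (simp add: span_scale span_base)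
        then show False using False by (simp add: w'_def)
      qed
      obtain k where k: "T (T w) + b *\<^sub>R T w + c *\<^sub>R w = k *\<^sub>R u"
        using q by (auto simp: span_singleton)
      have "T (T w') + b *\<^sub>R T w' + c *\<^sub>R w'
          = T (T (T w) + b *\<^sub>R T w + c *\<^sub>R w) - l *\<^sub>R (T (T w) + b *\<^sub>R T w + c *\<^sub>R w)"
        by (simp add: w'_def linear_add[OF T] linear_diff[OF T] linear_scale[OF T] algebra_simps)
      also have "\<dots> = 0" unfolding k by (simp add: linear_scale[OF T] l)
      finally have q': "T (T w') + b *\<^sub>R T w' + c *\<^sub>R w' = 0" .
      show ?thesis
      proof (cases "T w' \<in> span {w'}")
        case True
        then have "T w' \<in> span {u, w'}" using span_mono[of "{w'}" "{u, w'}"] by auto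
        then show ?thesis using span_pair_invariant[OF T u(1) w'] l by (simp add: span_base span_scale)
      next
        case False
        have "w' \<noteq> 0" using w' span_0 by metis
        then show ?thesis using plane_of_quad q' False by blast
      qed
    qed
  qed
qed

section \<open>Normalised affine maps with an invariant circle\<close>

text \<open>
  A ray from a point of the open unit ball, here \<open>- b\<close>, meets the unit sphere only once. This is the
  injectivity of the normalised affine map.
\<close>

lemma unit_vectors_on_same_ray:
  fixes b :: "'a::real_normed_vector"
  assumes "norm b < 1" "norm x = 1" "norm y = 1" "s > 0" "b + x = s *\<^sub>R (b + y)"
  shows "x = y"
proof -
  have *: "s \<le> 1" if "norm x = 1" "norm y = 1" "b + x = s *\<^sub>R (b + y)" for s :: real and x y
  proof (rule ccontr)
    assume "\<not> s \<le> 1"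
    then have s: "s > 1" by simp
    have "s *\<^sub>R y = x - (s - 1) *\<^sub>R b" using that(3) by (simp add: algebra_simps)
    then have "norm (s *\<^sub>R y) \<le> norm x + norm ((s - 1) *\<^sub>R b)" by (metis norm_triangle_ineq4)
    then have "s \<le> 1 + (s - 1) * norm b" using s that by simp
    moreover have "(s - 1) * norm b < (s - 1) * 1" using s assms(1) by (intro mult_strict_left_mono) auto
    ultimately show False by simp
  qed
  have "b + y = (1 / s) *\<^sub>R (b + x)" using assms by simp
  then have "1 / s \<le> 1" using *[of y x "1 / s"] assms by simp
  moreover have "s \<le> 1" using *[of x y s] assms by simp
  ultimately have "s = 1" using \<open>s > 0\<close> by simp
  then show ?thesis using assms by simp
qed

text \<open>
  With \<open>a = T b\<close> the map is \<open>x \<mapsto> T (b + x)\<close> followed by radial projection. Preimages of \<open>T w\<close>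
  come from the point where the ray \<open>s w - b\<close>, \<open>s \<ge> 0\<close>, leaves the unit ball.
\<close>

lemma normalized_affine_homeomorphism:
  fixes T :: "real ^ 'm ^ 'm"
  assumes T: "invertible T" and b: "norm b < 1"
  obtains g where "homeomorphism (sphere 0 1) (sphere 0 1) (normalized_affine T (T *v b)) g"
proof -
  let ?f = "normalized_affine T (T *v b)" and ?S = "sphere (0 :: real ^ 'm) 1"
  have f: "?f x = (1 / norm (T *v (b + x))) *\<^sub>R (T *v (b + x))" for x
    by (simp add: normalized_affine_def matrix_vector_right_distrib)
  have inj: "inj ((*v) T)" using T by (simp add: inj_matrix_vector_mult)
  have surj: "surj ((*v) T)" using T by (metis invertible_def matrix_right_invertible_surjective)
  have nz: "T *v (b + x) \<noteq> 0" if "x \<in> ?S" for x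
  proof
    assume "T *v (b + x) = 0"
    then have "b + x = 0" using injD[OF inj, of "b + x" 0] by simp
    then have "norm x = norm b" by (metis add.inverse_unique norm_minus_cancel)
    with b that show False by simp
  qed
  have cont: "continuous_on ?S ?f"
    unfolding f by (intro continuous_intros matrix_vector_mult_linear_continuous_on continuous_on_compose2[OF matrix_vector_mult_linear_continuous_on]) (use nz in auto)
  have "?f x \<in> ?S" if "x \<in> ?S" for x using nz[OF that] by (simp add: f)
  moreover have "y \<in> ?f ` ?S" if "y \<in> ?S" for y
  proof -
    obtain w where w: "T *v w = y" using surj by (metis surjD)
    then have "w \<noteq> 0" using that by auto
    have "\<exists>s\<ge>0. s \<le> 2 / norm w \<and> norm (s *\<^sub>R w - b) = 1"
    proof (rule IVT')
      have "norm ((2 / norm w) *\<^sub>R w) = 2" using \<open>w \<noteq> 0\<close> by simp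
      then show "1 \<le> norm ((2 / norm w) *\<^sub>R w - b)"
        using norm_triangle_ineq2[of "(2 / norm w) *\<^sub>R w" b] b by simp
    qed (use b in \<open>auto intro!: continuous_intros\<close>)
    then obtain s where s: "s \<ge> 0" "norm (s *\<^sub>R w - b) = 1" by blast
    then have "s \<noteq> 0" using b by auto
    have "?f (s *\<^sub>R w - b) = y"
      using that w s \<open>s \<noteq> 0\<close> by (simp add: f matrix_vector_mult_scaleR)
    then show ?thesis using s by (intro image_eqI[of _ _ "s *\<^sub>R w - b"]) auto
  qed
  ultimately have "?f ` ?S = ?S" by blast
  moreover have "inj_on ?f ?S"
  proof (rule inj_onI)
    fix x y assume xy: "x \<in> ?S" "y \<in> ?S" "?f x = ?f y"
    let ?s = "norm (T *v (b + x)) / norm (T *v (b + y))"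
    have "T *v (b + x) = norm (T *v (b + x)) *\<^sub>R ?f x" using nz[OF xy(1)] by (simp add: f)
    also have "\<dots> = T *v (?s *\<^sub>R (b + y))" unfolding xy(3) by (simp add: f matrix_vector_mult_scaleR)
    finally have "b + x = ?s *\<^sub>R (b + y)" by (rule injD[OF inj])
    then show "x = y"
      using unit_vectors_on_same_ray[OF b, of x y ?s] xy nz by simp
  qed
  ultimately show ?thesis using homeomorphism_compact[OF compact_sphere cont] that by blast
qed

locale orthonormal_pair =
  fixes u v :: "'a::real_inner"
  assumes uv: "norm u = 1" "norm v = 1" "u \<bullet> v = 0"
begin

definition circle :: "real \<Rightarrow> 'a" where
  "circle t = cos (2 * pi * t) *\<^sub>R u + sin (2 * pi * t) *\<^sub>R v"

lemma inner_uv: "u \<bullet> u = 1" "v \<bullet> v = 1" "u \<bullet> v = 0" "v \<bullet> u = 0"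
  using uv by (simp_all add: norm_eq_1 inner_commute)

lemma norm_comb: "(norm (a *\<^sub>R u + b *\<^sub>R v))\<^sup>2 = a\<^sup>2 + b\<^sup>2"
  unfolding power2_norm_eq_inner by (simp add: inner_add inner_uv power2_eq_square)

lemma circle_inner: "circle t \<bullet> u = cos (2 * pi * t)" "circle t \<bullet> v = sin (2 * pi * t)"
  by (simp_all add: circle_def inner_add inner_uv)

lemma norm_circle: "norm (circle t) = 1"
proof -
  have "(norm (circle t))\<^sup>2 = 1\<^sup>2" using norm_comb by (simp add: circle_def)
  then show ?thesis by (rule power2_eq_imp_eq) simp_all
qed

lemma circle_in_span: "circle t \<in> span {u, v}"
  unfolding circle_def by (intro span_add span_scale span_base) auto

lemma continuous_circle: "continuous_on UNIV circle"
  unfolding circle_def by (intro continuous_intros)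

sublocale circle_cover circle "4 * pi"
proof
  fix s t :: real
  have "circle s = circle t \<longleftrightarrow> sin (2 * pi * t) = sin (2 * pi * s) \<and> cos (2 * pi * t) = cos (2 * pi * s)"
    by (metis circle_inner circle_def)
  also have "\<dots> \<longleftrightarrow> (\<exists>k::int. 2 * pi * t = 2 * pi * s + 2 * pi * k)" by (rule sin_cos_eq_iff)
  also have "\<dots> \<longleftrightarrow> (\<exists>k::int. t - s = of_int k)"
    by (simp add: distrib_left[symmetric] mult.assoc del: distrib_left_numeral) (metis add_diff_cancel_left' add.commute diff_add_cancel)
  finally show "circle s = circle t \<longleftrightarrow> t - s \<in> \<int>" by (auto elim: Ints_cases)
next
  fix s t :: real
  let ?a = "2 * pi * s" and ?b = "2 * pi * t"
  have half: "\<bar>sin ((x - y) / 2)\<bar> \<le> \<bar>x - y\<bar> / 2" for x y :: real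
    using abs_sin_x_le_abs_x[of "(x - y) / 2"] by simp
  have prod: "\<bar>2 * p * q\<bar> \<le> 2 * r" if "\<bar>p\<bar> \<le> 1" "\<bar>q\<bar> \<le> r" for p q r :: real
    using mult_mono[OF that] by (simp add: abs_mult)
  have c: "\<bar>cos ?a - cos ?b\<bar> \<le> \<bar>?a - ?b\<bar>"
    unfolding cos_diff_cos using prod[OF abs_sin_le_one half[of ?b ?a]] by (simp add: abs_minus_commute)
  have "\<bar>2 * cos ((?a + ?b) / 2) * sin ((?a - ?b) / 2)\<bar> \<le> 2 * (\<bar>?a - ?b\<bar> / 2)"
    by (rule prod[OF abs_cos_le_one half])
  then have "\<bar>sin ?a - sin ?b\<bar> \<le> \<bar>?a - ?b\<bar>"
    unfolding sin_diff_sin by (simp only: mult.assoc mult.commute[of "cos _"]) simp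
  then have "\<bar>cos ?a - cos ?b\<bar> + \<bar>sin ?a - sin ?b\<bar> \<le> 2 * \<bar>?a - ?b\<bar>" using c by simp
  moreover have "circle s - circle t = (cos ?a - cos ?b) *\<^sub>R u + (sin ?a - sin ?b) *\<^sub>R v"
    by (simp add: circle_def algebra_simps)
  then have "dist (circle s) (circle t) \<le> \<bar>cos ?a - cos ?b\<bar> + \<bar>sin ?a - sin ?b\<bar>"
    unfolding dist_norm using norm_triangle_ineq[of "(cos ?a - cos ?b) *\<^sub>R u" "(sin ?a - sin ?b) *\<^sub>R v"] uv by simp
  moreover have "2 * \<bar>?a - ?b\<bar> = 4 * pi * \<bar>s - t\<bar>"
    using abs_mult[of "2 * pi" "s - t"] by (simp add: right_diff_distrib)
  ultimately show "dist (circle s) (circle t) \<le> 4 * pi * \<bar>s - t\<bar>" by simp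
qed simp

text \<open>
  In the coordinates \<open>u\<close>, \<open>v\<close> the path becomes a path of unit complex numbers. The line is contractible,
  so this path has a continuous logarithm, whose imaginary part is the lift.
\<close>

lemma lift_to_circle:
  fixes h :: "real \<Rightarrow> 'a"
  assumes cont: "continuous_on UNIV h" and h: "\<And>t. h t \<in> span {u, v}" "\<And>t. norm (h t) = 1"
  obtains H where "continuous_on UNIV H" "\<And>t. circle (H t) = h t"
proof -
  define \<zeta> where "\<zeta> t = Complex (h t \<bullet> u) (h t \<bullet> v)" for t
  have expand: "h t = (h t \<bullet> u) *\<^sub>R u + (h t \<bullet> v) *\<^sub>R v" for t
  proof -
    obtain a where "h t - a *\<^sub>R u \<in> span {v}" using h(1)[of t] by (auto simp: span_insert)
    then obtain b where "h t - a *\<^sub>R u = b *\<^sub>R v" by (auto simp: span_singleton)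
    then have "h t = a *\<^sub>R u + b *\<^sub>R v" by (simp add: algebra_simps)
    then show ?thesis by (simp add: inner_add inner_uv)
  qed
  have norm_\<zeta>: "norm (\<zeta> t) = 1" for t
    using norm_comb[of "h t \<bullet> u" "h t \<bullet> v"] h(2)[of t]
    by (simp add: \<zeta>_def complex_norm flip: expand)
  have "continuous_on UNIV \<zeta>"
    unfolding \<zeta>_def Complex_eq by (intro continuous_intros cont)
  then obtain l where l: "continuous_on UNIV l" "\<And>t. \<zeta> t = exp (l t)"
    using continuous_logarithm_on_contractible[of UNIV \<zeta>] norm_\<zeta>
    by (metis UNIV_I contractible_UNIV norm_zero zero_neq_one)
  have "Re (l t) = 0" for t using norm_\<zeta>[of t] by (simp add: l(2) norm_exp_eq_Re)
  then have cis: "\<zeta> t = cis (Im (l t))" for t by (simp add: l(2) exp_eq_polar)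
  show ?thesis
  proof
    show "continuous_on UNIV (\<lambda>t. Im (l t) / (2 * pi))" by (intro continuous_intros l(1)) simp
    fix t
    have "h t \<bullet> u = cos (Im (l t))" "h t \<bullet> v = sin (Im (l t))"
      using cis[of t] by (simp_all add: \<zeta>_def complex_eq_iff)
    then show "circle (Im (l t) / (2 * pi)) = h t" using expand[of t] by (simp add: circle_def)
  qed
qed

end

lemma orthonormal_pair_of_plane:
  fixes P :: "'a::euclidean_space set"
  assumes "subspace P" "dim P = 2"
  obtains u v where "orthonormal_pair u v" "P = span {u, v}"
proof -
  obtain B where B: "pairwise orthogonal B" "\<And>x. x \<in> B \<Longrightarrow> norm x = 1" "card B = dim P" "span B = P"
    by (rule orthonormal_basis_subspace[OF assms(1)]) blast
  then obtain u v where uv: "B = {u, v}" "u \<noteq> v" using assms(2) by (metis card_2_iff)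
  then have "orthonormal_pair u v"
    using B by unfold_locales (auto simp: pairwise_def orthogonal_def)
  then show ?thesis using that B(4) uv(1) by blast
qed

theorem theorem14:
  fixes n :: nat and T :: "real ^ 'm ^ 'm"
  assumes "n \<ge> 1" and "CARD('m) = n + 1" and "invertible T"
  shows "uncountable {a :: real ^ 'm. a \<noteq> 0 \<and>
           self_homeomorphism (sphere 0 1) (normalized_affine T a) \<and>
           \<not> expansive_on (sphere 0 1) (normalized_affine T a)}"
proof -
  let ?S = "sphere (0 :: real ^ 'm) 1"
  have inj: "inj ((*v) T)" using assms(3) by (simp add: inj_matrix_vector_mult)
  have "\<exists>P. subspace P \<and> dim P = 2 \<and> (*v) T ` P \<subseteq> P"
    by (rule invariant_plane) (use assms in \<open>simp_all add: matrix_vector_mul_linear\<close>)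
  then obtain P where P: "subspace P" "dim P = 2" "(*v) T ` P \<subseteq> P" by blast
  have "(*v) T ` P = P"
    by (rule subspace_dim_equal)
      (use P inj in \<open>simp_all add: linear_subspace_image dim_image_eq inj_on_subset[OF inj]\<close>)
  then have TP: "T *v x \<in> P \<longleftrightarrow> x \<in> P" for x using inj by (metis image_iff injD)
  obtain u v where "orthonormal_pair u v" and P_span: "P = span {u, v}"
    using orthonormal_pair_of_plane[OF P(1,2)] .
  then interpret orthonormal_pair u v by simp
  have good: "self_homeomorphism ?S (normalized_affine T (T *v b)) \<and>
      \<not> expansive_on ?S (normalized_affine T (T *v b))" if b: "norm b < 1" "b \<in> P" for b
  proof -
    let ?f = "normalized_affine T (T *v b)"
    obtain g where hom: "homeomorphism ?S ?S ?f g"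
      using normalized_affine_homeomorphism[OF assms(3) b(1)] .
    have eS: "circle t \<in> ?S" and eP: "circle t \<in> P" for t
      by (simp_all add: norm_circle P_span circle_in_span)
    have fS: "?f x \<in> ?S" and gS: "g x \<in> ?S" and fg: "?f (g x) = x" if "x \<in> ?S" for x
      using hom that by (auto simp: homeomorphism_def)
    have fP: "?f x \<in> P \<longleftrightarrow> x \<in> P" if "x \<in> ?S" for x
    proof -
      have f: "?f x = (1 / norm (T *v (b + x))) *\<^sub>R (T *v (b + x))"
        by (simp add: normalized_affine_def matrix_vector_right_distrib)
      have "T *v (b + x) \<noteq> 0" using fS[OF that] f by auto
      then have "T *v (b + x) = norm (T *v (b + x)) *\<^sub>R ?f x" by (simp add: f)
      then have "?f x \<in> P \<longleftrightarrow> T *v (b + x) \<in> P"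
        using f subspace_scale[OF P(1)] by metis
      also have "\<dots> \<longleftrightarrow> x \<in> P"
        unfolding TP using P(1) b(2) by (metis add_diff_cancel_left' subspace_add subspace_diff)
      finally show ?thesis .
    qed
    have cf: "continuous_on UNIV (\<lambda>t. ?f (circle t))" and cg: "continuous_on UNIV (\<lambda>t. g (circle t))"
      using hom eS by (auto simp: homeomorphism_def intro!: continuous_on_compose2[OF _ continuous_circle])
    obtain F where F: "continuous_on UNIV F" "\<And>t. circle (F t) = ?f (circle t)"
      by (rule lift_to_circle[OF cf]) (use fP eP eS fS P_span in auto)
    have gP: "g (circle t) \<in> P" for t using fP[OF gS[OF eS]] fg[OF eS] eP by metis
    obtain G where G: "continuous_on UNIV G" "\<And>t. circle (G t) = g (circle t)"
      by (rule lift_to_circle[OF cg]) (use gP eS gS P_span in auto)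
    show ?thesis
      using not_expansive_if_lifts[OF compact_sphere eS hom F G] hom by (auto simp: self_homeomorphism_def)
  qed
  have uv_nz: "u \<noteq> 0" using inner_uv(1) by auto
  have "uncountable {0<..<1::real}" by (simp add: uncountable_open_interval)
  moreover have "inj_on (\<lambda>c. T *v (c *\<^sub>R u)) {0<..<1}"
    using injD[OF inj] uv_nz by (intro inj_onI) (metis scaleR_cancel_right)
  ultimately have "uncountable ((\<lambda>c. T *v (c *\<^sub>R u)) ` {0<..<1})"
    by (metis countable_image_inj_on)
  moreover have "(\<lambda>c. T *v (c *\<^sub>R u)) ` {0<..<1} \<subseteq> {a. a \<noteq> 0 \<and>
      self_homeomorphism ?S (normalized_affine T a) \<and> \<not> expansive_on ?S (normalized_affine T a)}"
  proof clarify
    fix c :: real assume c: "c \<in> {0<..<1}"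
    have "T *v (c *\<^sub>R u) \<noteq> 0"
      using injD[OF inj, of "c *\<^sub>R u" 0] c uv_nz by auto
    moreover have "norm (c *\<^sub>R u) < 1" "c *\<^sub>R u \<in> P"
      using c inner_uv(1) by (simp_all add: P_span span_scale span_base norm_eq_sqrt_inner)
    ultimately show "T *v (c *\<^sub>R u) \<noteq> 0 \<and> self_homeomorphism ?S (normalized_affine T (T *v (c *\<^sub>R u))) \<and>
      \<not> expansive_on ?S (normalized_affine T (T *v (c *\<^sub>R u)))" using good by blast
  qed
  ultimately show ?thesis using countable_subset by blast
qed

end
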